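(* Neither the class of $K_4$-free disk graphs nor the class of disk graphs with ply $3$ has truly sublinear treewidth (with any parameter $\lambda\in(0,1)$).
   Context: A disk graph is the intersection graph of a finite family of closed disks (of arbitrary radii) in $\mathbb{R}^2$. A disk graph generated by a family of disks has ply $\ell$ if every point of the plane is contained in at most $\ell$ of the disks; "disk graphs with ply 3" means disk graphs admitting a generating family of disks of ply $3$. A graph is $K_4$-free if it has no complete graph on $4$ vertices as an induced subgraph. $\mathbf{tw}$ denotes treewidth; $G\setminus X$ is the subgraph induced by $V(G)\setminus X$. A graph class $\mathcal{G}$ has truly sublinear treewidth with parameter $\lambda\in(0,1)$ if for every $\eta>0$ there is $\beta>0$ such that for all $G\in\mathcal{G}$ and $X\subseteq V(G)$, $\mathbf{tw}(G\setminus X)\le\eta$ implies $\mathbf{tw}(G)\le\eta+\beta|X|^\lambda$. *)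

theory Defs
  imports "HOL-Analysis.Analysis" "Graph_Theory.Graph_Theory"
begin

text \<open>
  A finite simple graph is a \<^const>\<open>pair_graph\<close>: every undirected edge is represented by its two
  opposite arcs.
\<close>

section \<open>Treewidth\<close>

text \<open>
  \<^const>\<open>Digraph_Component.tree\<close> is not usable here: in a symmetric digraph the closed walk
  \<open>u, v, u\<close> is a \<^const>\<open>pre_digraph.cycle\<close>, so no graph with an edge would be a tree. The cycles of
  the undirected graph are those of length at least 3.
\<close>

definition undirected_tree :: "'a pair_pre_digraph \<Rightarrow> bool" where
  "undirected_tree T \<longleftrightarrow>
     pair_graph T \<and> Digraph_Component.connected (with_proj T) \<and>
     \<not> (\<exists>p. pre_digraph.cycle (with_proj T) p \<and> length p \<ge> 3)"

text \<open>
  \<^const>\<open>Digraph_Component.connected\<close> includes nonemptiness, so the last condition below also says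
  that every vertex lies in some bag.
\<close>

definition tree_decomposition ::
  "('a, 'b) pre_digraph \<Rightarrow> 't pair_pre_digraph \<Rightarrow> ('t \<Rightarrow> 'a set) \<Rightarrow> bool" where
  "tree_decomposition G T B \<longleftrightarrow>
     undirected_tree T \<and>
     (\<forall>t\<in>pverts T. B t \<subseteq> verts G) \<and>
     (\<forall>(u, v)\<in>arcs_ends G. \<exists>t\<in>pverts T. u \<in> B t \<and> v \<in> B t) \<and>
     (\<forall>v\<in>verts G. Digraph_Component.connected
        (induce_subgraph (with_proj T) {t\<in>pverts T. v \<in> B t}))"

definition decomposition_width :: "'t pair_pre_digraph \<Rightarrow> ('t \<Rightarrow> 'a set) \<Rightarrow> int" where
  "decomposition_width T B = int (MAX t\<in>pverts T. card (B t)) - 1"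

text \<open>Every finite tree has an isomorphic copy with nodes in \<^typ>\<open>nat\<close>.\<close>

definition treewidth :: "('a, 'b) pre_digraph \<Rightarrow> int" where
  "treewidth G =
     Inf {decomposition_width T B | (T :: nat pair_pre_digraph) B. tree_decomposition G T B}"

definition delete_verts :: "('a, 'b) pre_digraph \<Rightarrow> 'a set \<Rightarrow> ('a, 'b) pre_digraph" where
  "delete_verts G X = induce_subgraph G (verts G - X)"

definition truly_sublinear_treewidth :: "'a pair_pre_digraph set \<Rightarrow> real \<Rightarrow> bool" where
  "truly_sublinear_treewidth \<G> lam \<longleftrightarrow>
     (\<forall>\<eta>::real. \<eta> > 0 \<longrightarrow> (\<exists>\<beta>::real. \<beta> > 0 \<and>
        (\<forall>G\<in>\<G>. \<forall>X\<subseteq>pverts G.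
           real_of_int (treewidth (delete_verts (with_proj G) X)) \<le> \<eta> \<longrightarrow>
           real_of_int (treewidth (with_proj G)) \<le> \<eta> + \<beta> * real (card X) powr lam)))"

section \<open>Disk graphs\<close>

definition intersection_graph :: "'i set \<Rightarrow> ('i \<Rightarrow> 'p set) \<Rightarrow> 'i pair_pre_digraph" where
  "intersection_graph I D =
     \<lparr> pverts = I, parcs = {(i, j). i \<in> I \<and> j \<in> I \<and> i \<noteq> j \<and> D i \<inter> D j \<noteq> {}} \<rparr>"

lemma pair_graph_intersection_graph:
  assumes "finite I"
  shows "pair_graph (intersection_graph I D)"
proof -
  have "parcs (intersection_graph I D) \<subseteq> I \<times> I"
    by (auto simp: intersection_graph_def)
  then have "finite (parcs (intersection_graph I D))"
    using assms finite_subset by blast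
  with assms show ?thesis
    by unfold_locales (auto simp: intersection_graph_def symmetric_def sym_def)
qed

definition closed_disk :: "(real ^ 2) set \<Rightarrow> bool" where
  "closed_disk S \<longleftrightarrow> (\<exists>c r. r > 0 \<and> S = cball c r)"

definition disk_family :: "'i set \<Rightarrow> ('i \<Rightarrow> (real ^ 2) set) \<Rightarrow> bool" where
  "disk_family I D \<longleftrightarrow> finite I \<and> (\<forall>i\<in>I. closed_disk (D i))"

definition has_ply :: "'i set \<Rightarrow> ('i \<Rightarrow> (real ^ 2) set) \<Rightarrow> nat \<Rightarrow> bool" where
  "has_ply I D l \<longleftrightarrow> (\<forall>x. card {i\<in>I. x \<in> D i} \<le> l)"

text \<open>
  Indexing families by arbitrary finite sets of natural numbers gives, up to isomorphism, all
  finite families.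
\<close>

definition disk_graphs :: "nat pair_pre_digraph set" where
  "disk_graphs = {intersection_graph I D | I D. disk_family I D}"

definition disk_graphs_ply :: "nat \<Rightarrow> nat pair_pre_digraph set" where
  "disk_graphs_ply l = {intersection_graph I D | I D. disk_family I D \<and> has_ply I D l}"

definition K4_free :: "'a pair_pre_digraph \<Rightarrow> bool" where
  "K4_free G \<longleftrightarrow> \<not> (\<exists>H. induced_subgraph H (with_proj G) \<and> complete_digraph 4 H)"

end

theory Submission
  imports Defs "HOL-Real_Asymp.Real_Asymp"
begin

text \<open>
  Take \<open>k\<close> pairwise disjoint large disks side by side and \<open>k\<close> horizontal rows of touching small disks,
  each row passing through all large disks. A clique contains at most one large and two small disks,
  so this graph is \<open>K\<^sub>4\<close>-free and the family has ply 3. Deleting the \<open>k\<close> large disks leaves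
  disjoint paths, of treewidth at most 1. On the other hand the unions of one large disk with one row
  form a bramble, which needs \<open>k\<close> vertices to be hit: fewer vertices miss a large disk and a row. By
  the Helly property of subtrees some bag of every tree decomposition hits the whole bramble, so the
  treewidth is at least \<open>k - 1\<close>, which is not in \<open>O(k\<^sup>\<lambda>)\<close> for \<open>\<lambda> < 1\<close>.
\<close>

section \<open>Connected vertex sets and subtrees\<close>

text \<open>Walks must stay inside \<open>S\<close>. The empty set counts as connected, so
  nonemptiness is demanded separately wherever it matters.\<close>

definition connected_on :: "'a rel \<Rightarrow> 'a set \<Rightarrow> bool" where
  "connected_on E S \<longleftrightarrow> (\<forall>x\<in>S. \<forall>y\<in>S. (x, y) \<in> (Restr E S)\<^sup>*)"

lemma connected_on_insert:
  assumes S: "connected_on E S" and u: "u \<in> S" "(u, v) \<in> E" "(v, u) \<in> E"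
  shows "connected_on E (insert v S)"
proof -
  let ?R = "Restr E (insert v S)"
  have "Restr E S \<subseteq> ?R" by auto
  then have old: "(x, y) \<in> ?R\<^sup>*" if "x \<in> S" "y \<in> S" for x y
    using S that unfolding connected_on_def by (meson rtrancl_mono subsetD)
  have "(u, v) \<in> ?R" "(v, u) \<in> ?R" using u by auto
  then have "(x, u) \<in> ?R\<^sup>* \<and> (u, x) \<in> ?R\<^sup>*" if "x \<in> insert v S" for x
    using that old[of x u] old[of u x] u(1) by auto
  then show ?thesis
    unfolding connected_on_def by (meson rtrancl_trans)
qed

lemma rtrancl_on_Restr:
  assumes "x \<in> S"
  shows "(x, y) \<in> rtrancl_on S (Restr E S) \<longleftrightarrow> (x, y) \<in> (Restr E S)\<^sup>*"
proof
  assume "(x, y) \<in> (Restr E S)\<^sup>*"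
  then show "(x, y) \<in> rtrancl_on S (Restr E S)"
    using assms by (induction rule: rtrancl_induct) (auto intro: rtrancl_on_into_rtrancl_on)
qed (rule rtrancl_on_rtranclI)

text \<open>Translates the subtree condition of tree decompositions into
  \<open>connected_on\<close>; symmetry of the arcs means that the symmetric closure taken by
  \<open>connected\<close> adds nothing.\<close>

lemma connected_induce_subgraph_iff:
  assumes "sym (parcs T)"
  shows "Digraph_Component.connected (induce_subgraph (with_proj T) S) \<longleftrightarrow>
    S \<noteq> {} \<and> connected_on (parcs T) S"
proof -
  have "parcs (mk_symmetric (induce_subgraph (with_proj T) S)) = Restr (parcs T) S"
    using assms by (auto simp: parcs_mk_symmetric dest: symD)
  then show ?thesis
    by (simp add: Digraph_Component.connected_def strongly_connected_def reachable_def
        rtrancl_on_Restr connected_on_def)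
qed

lemma connected_on_pverts:
  assumes "pair_graph T" and "Digraph_Component.connected (with_proj T)"
  shows "pverts T \<noteq> {}" and "x \<in> pverts T \<Longrightarrow> y \<in> pverts T \<Longrightarrow> (x, y) \<in> (parcs T)\<^sup>*"
proof -
  interpret pair_graph T by fact
  have "parcs (mk_symmetric (with_proj T)) = parcs T"
    by (auto simp: parcs_mk_symmetric dest: arcs_symmetric)
  with assms(2) show "pverts T \<noteq> {}"
    and "x \<in> pverts T \<Longrightarrow> y \<in> pverts T \<Longrightarrow> (x, y) \<in> (parcs T)\<^sup>*"
    by (auto simp: Digraph_Component.connected_def strongly_connected_def reachable_def
        intro: rtrancl_on_rtranclI)
qed

section \<open>Bridges and the Helly property in trees\<close>

lemma undirected_tree_sym:
  assumes "undirected_tree T"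
  shows "sym (parcs T)"
proof -
  interpret pair_graph T using assms by (simp add: undirected_tree_def)
  show ?thesis by (auto intro: symI arcs_symmetric)
qed

text \<open>A detour around the edge, shortened to a simple path, has at least two arcs and closes
  with \<open>(t, s)\<close> to a cycle of length at least 3.\<close>

lemma undirected_tree_edge_is_bridge:
  assumes T: "undirected_tree T" and st: "(s, t) \<in> parcs T"
  shows "(s, t) \<notin> (parcs T - {(s, t), (t, s)})\<^sup>*"
proof
  let ?E = "parcs T - {(s, t), (t, s)}"
  assume reach: "(s, t) \<in> ?E\<^sup>*"
  interpret T: pair_graph T
    using T by (simp add: undirected_tree_def)
  have ends: "s \<in> pverts T" "t \<in> pverts T" "s \<noteq> t"
    using st T.in_arcsD1 T.in_arcsD2 T.no_loops' by auto
  define H where "H = \<lparr>pverts = pverts T, parcs = ?E\<rparr>"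
  interpret H: pair_wf_digraph H
    by unfold_locales (auto simp: H_def T.in_arcsD1 T.in_arcsD2)
  have "(s, t) \<in> rtrancl_on (pverts T) ?E"
    using reach ends T.in_arcsD2 by (intro rtrancl_consistent_rtrancl_on) auto
  then have "s \<rightarrow>\<^sup>*\<^bsub>with_proj H\<^esub> t"
    by (simp add: reachable_def H_def)
  then obtain p where p: "H.apath s p t"
    using H.reachable_apath by blast
  then have "set p \<subseteq> parcs H" and cas: "pcas s p t" and dist: "distinct (pawalk_verts s p)"
    by (auto simp: H.apath_def H.awalk_def)
  then have pE: "set p \<subseteq> ?E" by (simp add: H_def)
  have len: "length p \<ge> 2"
  proof (cases p)
    case Nil
    then show ?thesis using cas ends by simp
  next
    case (Cons e q)
    then show ?thesis
      using cas pE by (cases q) (auto simp: prod_eq_iff)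
  qed
  have "T.awalk t ((t, s) # p) t"
    using st T.arcs_symmetric ends pE cas by (auto simp: T.awalk_def)
  then have "T.cycle ((t, s) # p)"
    using dist by (auto simp: T.cycle_def)
  then show False
    using T len unfolding undirected_tree_def
    by (metis Suc_le_mono length_Cons numeral_3_eq_3 numeral_2_eq_2)
qed

text \<open>Cut the walk at its last visit to \<open>t\<close>; the rest avoids
  \<open>t\<close>.\<close>

lemma rtrancl_last_exit:
  assumes "(t, x) \<in> E\<^sup>*" and "x \<noteq> t"
  shows "\<exists>s. (t, s) \<in> E \<and> (s, x) \<in> (Restr E (- {t}))\<^sup>*"
  using assms
proof (induction rule: rtrancl_induct)
  case (step y z)
  show ?case
  proof (cases "y = t")
    case False
    with step obtain s where "(t, s) \<in> E" "(s, y) \<in> (Restr E (- {t}))\<^sup>*"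
      by blast
    with False step show ?thesis
      by (blast intro: rtrancl_into_rtrancl)
  qed (use step in blast)
qed simp

text \<open>
  If no node lies in all subtrees, every node \<open>t\<close> misses some subtree \<open>S t\<close> and points to the
  neighbour \<open>f t\<close> in the direction of \<open>S t\<close>. When the branch \<open>C t\<close> that \<open>t\<close> points into is as small as
  possible, \<open>f t\<close> must point back to \<open>t\<close>; so the edge between them separates \<open>S t\<close> from \<open>S (f t)\<close>.
\<close>

lemma subtrees_Helly:
  assumes T: "undirected_tree T"
    and F: "\<And>S. S \<in> F \<Longrightarrow> connected_on (parcs T) S"
    and sub: "\<And>S. S \<in> F \<Longrightarrow> S \<subseteq> pverts T"
    and meet: "\<And>S S'. S \<in> F \<Longrightarrow> S' \<in> F \<Longrightarrow> S \<inter> S' \<noteq> {}"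
  shows "\<exists>t\<in>pverts T. \<forall>S\<in>F. t \<in> S"
proof (rule ccontr)
  let ?V = "pverts T" and ?E = "parcs T"
  define A where "A t = Restr ?E (- {t})" for t
  interpret T: pair_graph T
    using T by (simp add: undirected_tree_def)
  have conn: "?V \<noteq> {}" "\<And>x y. x \<in> ?V \<Longrightarrow> y \<in> ?V \<Longrightarrow> (x, y) \<in> ?E\<^sup>*"
    using T connected_on_pverts[of T] by (auto simp: undirected_tree_def)
  have symA: "(y, x) \<in> (A t)\<^sup>*" if "(x, y) \<in> (A t)\<^sup>*" for x y t
  proof -
    have "sym (A t)" by (auto simp: A_def sym_def T.arcs_symmetric)
    then show ?thesis using that by (metis sym_rtrancl symD)
  qed
  assume "\<not> ?thesis"
  then have "\<forall>t\<in>?V. \<exists>S\<in>F. t \<notin> S" by blast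
  then obtain S where S: "\<And>t. t \<in> ?V \<Longrightarrow> S t \<in> F \<and> t \<notin> S t"
    by metis
  have "\<exists>s. (t, s) \<in> ?E \<and> S t \<subseteq> {y. (s, y) \<in> (A t)\<^sup>*}" if t: "t \<in> ?V" for t
  proof -
    \<comment> \<open>Taking both sets equal in \<open>meet\<close> shows that \<open>S t\<close> is
      nonempty. Being connected and missing \<open>t\<close>, it lies in a single branch at
      \<open>t\<close>.\<close>
    from meet[of "S t" "S t"] S[OF t] obtain x where x: "x \<in> S t" by blast
    then have "x \<noteq> t" "(t, x) \<in> ?E\<^sup>*"
      using S[OF t] t sub conn by blast+
    then obtain s where s: "(t, s) \<in> ?E" "(s, x) \<in> (A t)\<^sup>*"
      using rtrancl_last_exit unfolding A_def by metis
    have "(x, y) \<in> (A t)\<^sup>*" if "y \<in> S t" for y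
    proof -
      have "(x, y) \<in> (Restr ?E (S t))\<^sup>*"
        using F[of "S t"] S[OF t] x that by (auto simp: connected_on_def)
      moreover have "Restr ?E (S t) \<subseteq> A t"
        using S[OF t] by (auto simp: A_def)
      ultimately show ?thesis by (meson rtrancl_mono subsetD)
    qed
    with s show ?thesis by (blast intro: rtrancl_trans)
  qed
  then obtain f where f: "\<And>t. t \<in> ?V \<Longrightarrow> (t, f t) \<in> ?E"
    and Sf: "\<And>t. t \<in> ?V \<Longrightarrow> S t \<subseteq> {y. (f t, y) \<in> (A t)\<^sup>*}"
    by metis
  define C where "C t = {y. (f t, y) \<in> (A t)\<^sup>*}" for t
  have finC: "finite (C t)" if "t \<in> ?V" for t
  proof (rule finite_subset)
    show "C t \<subseteq> ?V"
    proof
      fix y assume "y \<in> C t"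
      then have "(f t, y) \<in> (A t)\<^sup>*" by (simp add: C_def)
      then show "y \<in> ?V"
        using f[OF that] by (induction rule: rtrancl_induct) (auto simp: A_def T.in_arcsD2)
    qed
  qed (rule T.pair_finite_verts)
  obtain t where t: "t \<in> ?V" and min: "\<And>s. s \<in> ?V \<Longrightarrow> card (C t) \<le> card (C s)"
    using ex_has_least_nat[of "\<lambda>t. t \<in> ?V" _ "\<lambda>t. card (C t)"] conn(1) by blast
  define s where "s = f t"
  have ts: "(t, s) \<in> ?E" and sV: "s \<in> ?V" and "s \<noteq> t"
    using f[OF t] T.in_arcsD2[OF f[OF t]] T.no_loops'[OF f[OF t]] by (auto simp: s_def)
  have st: "(s, t) \<in> ?E" using ts T.arcs_symmetric by blast
  have bridge: "(s, t) \<notin> (?E - {(s, t), (t, s)})\<^sup>*"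
    using T st by (rule undirected_tree_edge_is_bridge)
  have Asub: "(A s)\<^sup>* \<subseteq> (?E - {(s, t), (t, s)})\<^sup>*" "(A t)\<^sup>* \<subseteq> (?E - {(s, t), (t, s)})\<^sup>*"
    by (intro rtrancl_mono; auto simp: A_def)+
  show False
  proof (cases "f s = t")
    case True
    \<comment> \<open>A common node \<open>y\<close> is joined to \<open>t\<close> avoiding
      \<open>s\<close> and to \<open>s\<close> avoiding \<open>t\<close>. Neither walk uses the
      edge, so together they bypass a bridge.\<close>
    from meet S t sV obtain y where "y \<in> S s" "y \<in> S t" by blast
    with Sf[OF t] Sf[OF sV] True have "(t, y) \<in> (A s)\<^sup>*" "(s, y) \<in> (A t)\<^sup>*"
      by (auto simp: s_def)
    then have "(s, y) \<in> (?E - {(s, t), (t, s)})\<^sup>*" "(y, t) \<in> (?E - {(s, t), (t, s)})\<^sup>*"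
      using symA Asub by blast+
    with bridge show False by (meson rtrancl_trans)
  next
    case False
    have sf: "(s, f s) \<in> ?E" using f[OF sV] .
    then have sf': "(s, f s) \<in> ?E - {(s, t), (t, s)}"
      using False \<open>s \<noteq> t\<close> by auto
    have no_t: "(f s, t) \<notin> (A s)\<^sup>*"
      using bridge sf' Asub by (meson converse_rtrancl_into_rtrancl subsetD)
    \<comment> \<open>By \<open>no_t\<close>, walks from \<open>f s\<close> that avoid
      \<open>s\<close> also avoid \<open>t\<close>, so the branch of \<open>s\<close> lies in that
      of \<open>t\<close>, properly because it lacks \<open>s\<close>.\<close>
    have "C s \<subseteq> C t"
    proof
      fix y assume "y \<in> C s"
      then have "(f s, y) \<in> (A s)\<^sup>*" by (simp add: C_def)
      then have "(s, y) \<in> (A t)\<^sup>*"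
      proof (induction rule: rtrancl_induct)
        case base
        then show ?case using sf False \<open>s \<noteq> t\<close> by (auto simp: A_def)
      next
        case (step y z)
        then have "y \<noteq> t" "z \<noteq> t"
          using no_t by (auto intro: rtrancl_into_rtrancl)
        with step show ?case
          by (auto simp: A_def intro: rtrancl_into_rtrancl)
      qed
      then show "y \<in> C t" by (simp add: C_def s_def)
    qed
    moreover have "s \<in> C t" by (simp add: C_def s_def)
    moreover have "s \<notin> C s"
    proof
      assume "s \<in> C s"
      then have "(f s, s) \<in> (A s)\<^sup>*" by (simp add: C_def)
      then show False
        using T.no_loops'[OF sf] by (cases rule: rtranclE) (auto simp: A_def)
    qed
    ultimately have "card (C s) < card (C t)"
      using finC[OF t] by (intro psubset_card_mono) auto
    with min[OF sV] show False by simp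
  qed
qed

section \<open>Brambles\<close>

definition bramble :: "'a rel \<Rightarrow> 'a set set \<Rightarrow> bool" where
  "bramble E \<B> \<longleftrightarrow>
     (\<forall>b\<in>\<B>. b \<noteq> {} \<and> connected_on E b) \<and>
     (\<forall>b\<in>\<B>. \<forall>c\<in>\<B>. b \<inter> c \<noteq> {} \<or> (\<exists>u\<in>b. \<exists>v\<in>c. (u, v) \<in> E))"

text \<open>Each vertex occupies a subtree, and adjacent vertices share a bag, so following a walk
  inside \<open>b\<close> links all these subtrees.\<close>

lemma tree_decomposition_connected_on:
  assumes TD: "tree_decomposition G T B"
    and b: "b \<subseteq> verts G" "connected_on (arcs_ends G) b"
  shows "connected_on (parcs T) {t \<in> pverts T. B t \<inter> b \<noteq> {}}"
  unfolding connected_on_def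
proof (intro ballI)
  let ?S = "{t \<in> pverts T. B t \<inter> b \<noteq> {}}"
  fix x y assume "x \<in> ?S" "y \<in> ?S"
  then obtain u v where x: "x \<in> pverts T" "u \<in> B x" "u \<in> b"
    and y: "y \<in> pverts T" "v \<in> B y" "v \<in> b"
    by blast
  have symT: "sym (parcs T)"
    using TD by (simp add: tree_decomposition_def undirected_tree_sym)
  have node: "(t, t') \<in> (Restr (parcs T) ?S)\<^sup>*"
    if "w \<in> b" "t \<in> pverts T" "t' \<in> pverts T" "w \<in> B t" "w \<in> B t'" for t t' w
  proof -
    have "connected_on (parcs T) {t \<in> pverts T. w \<in> B t}"
      using TD b(1) that(1) connected_induce_subgraph_iff[OF symT]
      by (auto simp: tree_decomposition_def)
    then have "(t, t') \<in> (Restr (parcs T) {t \<in> pverts T. w \<in> B t})\<^sup>*"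
      using that by (simp add: connected_on_def)
    moreover have "Restr (parcs T) {t \<in> pverts T. w \<in> B t} \<subseteq> Restr (parcs T) ?S"
      using that(1) by auto
    ultimately show ?thesis by (meson rtrancl_mono subsetD)
  qed
  have "(u, v) \<in> (Restr (arcs_ends G) b)\<^sup>*"
    using b(2) x y by (simp add: connected_on_def)
  then show "(x, y) \<in> (Restr (parcs T) ?S)\<^sup>*"
    using y
  proof (induction arbitrary: y rule: rtrancl_induct)
    case base
    then show ?case using node[of u x y] x by blast
  next
    case (step v w)
    then obtain t where "t \<in> pverts T" "v \<in> B t" "w \<in> B t"
      using TD by (fastforce simp: tree_decomposition_def)
    with step show ?case
      using node[of w t y] by (blast intro: rtrancl_trans)
  qed
qed

text \<open>The nodes whose bags meet a given member form a subtree. Touching members have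
  intersecting subtrees, so the Helly property gives a common node.\<close>

lemma bramble_covered_by_bag:
  assumes TD: "tree_decomposition G T B"
    and br: "bramble (arcs_ends G) \<B>" and sub: "\<And>b. b \<in> \<B> \<Longrightarrow> b \<subseteq> verts G"
  shows "\<exists>t\<in>pverts T. \<forall>b\<in>\<B>. B t \<inter> b \<noteq> {}"
proof -
  define S where "S b = {t \<in> pverts T. B t \<inter> b \<noteq> {}}" for b
  have T: "undirected_tree T" using TD by (simp add: tree_decomposition_def)
  have symT: "sym (parcs T)"
    using T by (rule undirected_tree_sym)
  have "\<exists>t\<in>pverts T. \<forall>U\<in>S ` \<B>. t \<in> U"
  proof (rule subtrees_Helly[OF T])
    fix U assume "U \<in> S ` \<B>"
    then show "connected_on (parcs T) U"
      using tree_decomposition_connected_on[OF TD sub] br by (auto simp: S_def bramble_def)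
  next
    fix U U' assume "U \<in> S ` \<B>" "U' \<in> S ` \<B>"
    then obtain b c where bc: "U = S b" "b \<in> \<B>" "U' = S c" "c \<in> \<B>" by blast
    then have "b \<inter> c \<noteq> {} \<or> (\<exists>u\<in>b. \<exists>v\<in>c. (u, v) \<in> arcs_ends G)"
      using br by (simp add: bramble_def)
    then consider v where "v \<in> b" "v \<in> c" | u v where "u \<in> b" "v \<in> c" "(u, v) \<in> arcs_ends G"
      by blast
    then show "U \<inter> U' \<noteq> {}"
    proof cases
      case (1 v)
      then have "{t \<in> pverts T. v \<in> B t} \<noteq> {}"
        using TD sub[OF bc(2)] connected_induce_subgraph_iff[OF symT]
        unfolding tree_decomposition_def by blast
      with 1 bc show ?thesis by (auto simp: S_def)
    next
      case (2 u v)
      then obtain t where "t \<in> pverts T" "u \<in> B t" "v \<in> B t"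
        using TD by (fastforce simp: tree_decomposition_def)
      with 2 bc show ?thesis by (auto simp: S_def)
    qed
  qed (auto simp: S_def)
  then show ?thesis by (auto simp: S_def)
qed

section \<open>Path graphs and bounds on treewidth\<close>

text \<open>Serves as the tree of decompositions: with one node for the trivial one, with
  \<open>n\<close> nodes for subgraphs of a path.\<close>

definition path_graph :: "nat \<Rightarrow> nat pair_pre_digraph" where
  "path_graph n = \<lparr>pverts = {..<n}, parcs = {(i, j). i < n \<and> j < n \<and> (j = Suc i \<or> i = Suc j)}\<rparr>"

lemma path_graph_simps [simp]:
  "pverts (path_graph n) = {..<n}"
  "(i, j) \<in> parcs (path_graph n) \<longleftrightarrow> i < n \<and> j < n \<and> (j = Suc i \<or> i = Suc j)"
  by (simp_all add: path_graph_def)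

lemma sym_path_graph: "sym (parcs (path_graph n))"
  by (auto simp: sym_def)

lemma pair_graph_path_graph: "pair_graph (path_graph n)"
proof -
  have "parcs (path_graph n) \<subseteq> {..<n} \<times> {..<n}" by auto
  then have "finite (parcs (path_graph n))" by (rule finite_subset) simp
  then show ?thesis
    by unfold_locales (auto simp: symmetric_def sym_path_graph)
qed

lemma connected_on_interval:
  assumes "\<And>i. a \<le> i \<Longrightarrow> Suc i < b \<Longrightarrow> (i, Suc i) \<in> E \<and> (Suc i, i) \<in> E"
  shows "connected_on E {a..<b}"
proof -
  have R: "(i, i + d) \<in> (Restr E {a..<b})\<^sup>* \<and> (i + d, i) \<in> (Restr E {a..<b})\<^sup>*"
    if "a \<le> i" "i + d < b" for i d
    using that
  proof (induction d)
    case (Suc d)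
    have "(i + d, Suc (i + d)) \<in> Restr E {a..<b}" "(Suc (i + d), i + d) \<in> Restr E {a..<b}"
      using assms[of "i + d"] Suc.prems by auto
    with Suc show ?case
      by (auto intro: rtrancl_into_rtrancl converse_rtrancl_into_rtrancl)
  qed simp
  have "(x, y) \<in> (Restr E {a..<b})\<^sup>*" if "x \<in> {a..<b}" "y \<in> {a..<b}" for x y
  proof (cases "x \<le> y")
    case True
    then show ?thesis using R[of x "y - x"] that by simp
  next
    case False
    then show ?thesis using R[of y "x - y"] that by simp
  qed
  then show ?thesis by (simp add: connected_on_def)
qed

text \<open>Here \<open>v\<close> is the vertex visited just before the walk. A simple walk that may
  not return to it must go up at every step.\<close>

lemma path_graph_walk_up:
  assumes "set p \<subseteq> parcs (path_graph n)" "pcas (Suc v) p u"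
    "distinct (pawalk_verts (Suc v) p)" "v \<notin> set (pawalk_verts (Suc v) p)"
  shows "u = Suc v + length p"
  using assms
proof (induction p arbitrary: v)
  case (Cons e p)
  then obtain x where e: "e = (Suc v, x)" by (cases e) auto
  have "x \<noteq> v" using Cons.prems(2,4) e by (cases p) auto
  then have x: "x = Suc (Suc v)" using Cons.prems(1) e by auto
  then show ?case using Cons.IH[of "Suc v"] Cons.prems e by simp
qed simp

lemma path_graph_walk_down:
  assumes "set p \<subseteq> parcs (path_graph n)" "pcas v p u"
    "distinct (pawalk_verts v p)" "Suc v \<notin> set (pawalk_verts v p)"
  shows "v = u + length p"
  using assms
proof (induction p arbitrary: v)
  case (Cons e p)
  then obtain x where e: "e = (v, x)" by (cases e) auto
  have "x \<noteq> Suc v" using Cons.prems(2,4) e by (cases p) auto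
  then have x: "v = Suc x" using Cons.prems(1) e by auto
  then show ?case using Cons.IH[of x] Cons.prems e by simp
qed simp

lemma undirected_tree_path_graph:
  assumes "n > 0"
  shows "undirected_tree (path_graph n)"
proof -
  interpret pair_graph "path_graph n" by (rule pair_graph_path_graph)
  have "{..<n} = {0..<n}" by auto
  then have "connected_on (parcs (path_graph n)) {..<n}"
    using connected_on_interval[of 0 n "parcs (path_graph n)"] by simp
  moreover have "induce_subgraph (with_proj (path_graph n)) {..<n} = with_proj (path_graph n)"
    by (auto simp: induce_subgraph_def with_proj_def)
  ultimately have "Digraph_Component.connected (with_proj (path_graph n))"
    using connected_induce_subgraph_iff[OF sym_path_graph, of n "{..<n}"] assms by auto
  moreover have False if "cycle p" "length p \<ge> 3" for p
  proof -
    from that obtain u where u: "awalk u p u" "distinct (tl (pawalk_verts u p))"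
      by (auto simp: cycle_def)
    \<comment> \<open>In \<open>cycle\<close> only the tail of the vertex list is distinct.
      Splitting off two arcs leaves a simple walk \<open>q\<close> from \<open>x\<close> to
      \<open>u\<close> that avoids \<open>w\<close>, hence runs monotonically away from
      \<open>w\<close> and cannot end at its neighbour \<open>u\<close>.\<close>
    from \<open>length p \<ge> 3\<close> obtain e e' q where p: "p = e # e' # q" "q \<noteq> []"
      by (cases p; cases "tl p"; cases "tl (tl p)") auto
    obtain w x where e: "e = (u, w)" "e' = (w, x)"
      using u p by (cases e; cases e') (auto simp: awalk_def)
    have walk: "set q \<subseteq> parcs (path_graph n)" "pcas x q u" "distinct (pawalk_verts x q)"
      "w \<notin> set (pawalk_verts x q)"
      using u p e by (auto simp: awalk_def)
    have arcs: "(u, w) \<in> parcs (path_graph n)" "(w, x) \<in> parcs (path_graph n)"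
      using u p e by (auto simp: awalk_def)
    then consider "x = Suc w" | "w = Suc x" by auto
    then show False
    proof cases
      case 1
      then have "u = x + length q" using path_graph_walk_up[of q n w u] walk by simp
      with 1 arcs p(2) show False by (cases q) auto
    next
      case 2
      then have "x = u + length q" using path_graph_walk_down[of q n x u] walk by simp
      with 2 arcs p(2) show False by (cases q) auto
    qed
  qed
  ultimately show ?thesis
    using pair_graph_path_graph by (auto simp: undirected_tree_def)
qed

section \<open>Upper and lower bounds on treewidth\<close>

lemma decomposition_width_ge:
  assumes "undirected_tree T" and "t \<in> pverts T"
  shows "decomposition_width T B \<ge> int (card (B t)) - 1"
proof -
  interpret pair_graph T using assms(1) by (simp add: undirected_tree_def)
  show ?thesis
    using Max_ge[OF finite_imageI[OF pair_finite_verts] imageI[OF assms(2)], of "\<lambda>t. card (B t)"]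
    by (simp add: decomposition_width_def)
qed

lemma treewidth_le:
  fixes T :: "nat pair_pre_digraph"
  assumes "tree_decomposition G T B"
  shows "treewidth G \<le> decomposition_width T B"
  unfolding treewidth_def
proof (rule cInf_lower)
  \<comment> \<open>An infimum of integers is a lower bound only for sets bounded below; a tree has
    a node, so every width is at least -1.\<close>
  show "bdd_below {decomposition_width T B |(T :: nat pair_pre_digraph) B. tree_decomposition G T B}"
  proof (rule bdd_belowI[of _ "- 1"], safe)
    fix T :: "nat pair_pre_digraph" and B
    assume "tree_decomposition G T B"
    then have T: "undirected_tree T" by (simp add: tree_decomposition_def)
    then obtain t where "t \<in> pverts T"
      using connected_on_pverts(1) by (auto simp: undirected_tree_def)
    from decomposition_width_ge[OF T this, of B] show "- 1 \<le> decomposition_width T B" by simp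
  qed
qed (use assms in blast)

text \<open>Makes the set of widths nonempty, as lower bounds on its infimum require.\<close>

lemma tree_decomposition_single_bag:
  assumes "wf_digraph G"
  shows "tree_decomposition G (path_graph 1) (\<lambda>_. verts G)"
proof -
  interpret wf_digraph G by fact
  have "connected_on (parcs (path_graph 1)) {t. t = 0}" by (simp add: connected_on_def)
  then show ?thesis
    using undirected_tree_path_graph[of 1]
      connected_induce_subgraph_iff[OF sym_path_graph, of 1 "{t. t = 0}"]
    by (auto simp: tree_decomposition_def arcs_ends_conv)
qed

lemma treewidth_ge_bramble_order:
  assumes G: "wf_digraph G" "finite (verts G)"
    and br: "bramble (arcs_ends G) \<B>" and sub: "\<And>b. b \<in> \<B> \<Longrightarrow> b \<subseteq> verts G"
    and order: "\<And>S. S \<subseteq> verts G \<Longrightarrow> (\<And>b. b \<in> \<B> \<Longrightarrow> S \<inter> b \<noteq> {}) \<Longrightarrow> k \<le> card S"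
  shows "treewidth G \<ge> int k - 1"
  unfolding treewidth_def
proof (rule cInf_greatest)
  show "{decomposition_width T B |(T :: nat pair_pre_digraph) B. tree_decomposition G T B} \<noteq> {}"
    using tree_decomposition_single_bag[OF G(1)] by blast
next
  fix w assume "w \<in> {decomposition_width T B |(T :: nat pair_pre_digraph) B. tree_decomposition G T B}"
  then obtain T :: "nat pair_pre_digraph" and B where
    w: "w = decomposition_width T B" and TD: "tree_decomposition G T B" by blast
  obtain t where t: "t \<in> pverts T" "\<forall>b\<in>\<B>. B t \<inter> b \<noteq> {}"
    using bramble_covered_by_bag[OF TD br sub] by blast
  have "k \<le> card (B t)"
    using t TD by (intro order) (auto simp: tree_decomposition_def)
  then show "int k - 1 \<le> w"
    using decomposition_width_ge[of T t B] t TD by (auto simp: w tree_decomposition_def)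
qed

lemma treewidth_subgraph_path_le_1:
  assumes n: "n > 0" and V: "verts G = {..<n}"
    and E: "\<And>i j. (i, j) \<in> arcs_ends G \<Longrightarrow> i < n \<and> j < n \<and> (j = Suc i \<or> i = Suc j)"
  shows "treewidth G \<le> 1"
proof -
  \<comment> \<open>The intersection trims the last bag, where \<open>Suc t\<close> is no longer a
    vertex.\<close>
  define B where "B t = {t, Suc t} \<inter> {..<n}" for t
  have "tree_decomposition G (path_graph n) B"
    unfolding tree_decomposition_def
  proof (intro conjI ballI)
    fix e assume e: "e \<in> arcs_ends G"
    obtain u v where uv: "e = (u, v)" by fastforce
    with e E have "u < n" "v < n" "v = Suc u \<or> u = Suc v" by blast+
    then have "min u v < n" "u \<in> B (min u v)" "v \<in> B (min u v)" by (auto simp: B_def)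
    then show "case e of (u, v) \<Rightarrow> \<exists>t\<in>pverts (path_graph n). u \<in> B t \<and> v \<in> B t"
      unfolding uv prod.case path_graph_simps by (intro bexI[of _ "min u v"]) auto
  next
    fix v assume "v \<in> verts G"
    \<comment> \<open>Truncated subtraction covers \<open>v = 0\<close>, which lies in the bag of
      node 0 only.\<close>
    then have "{t \<in> pverts (path_graph n). v \<in> B t} = {v - 1..<Suc v}"
      using V by (simp add: B_def set_eq_iff) arith
    moreover have "connected_on (parcs (path_graph n)) {v - 1..<Suc v}"
      using \<open>v \<in> verts G\<close> V by (intro connected_on_interval) auto
    ultimately show "Digraph_Component.connected
        (induce_subgraph (with_proj (path_graph n)) {t \<in> pverts (path_graph n). v \<in> B t})"
      using connected_induce_subgraph_iff[OF sym_path_graph] by simp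
  qed (use undirected_tree_path_graph[OF n] V in \<open>auto simp: B_def\<close>)
  then have "treewidth G \<le> decomposition_width (path_graph n) B" by (rule treewidth_le)
  also have "\<dots> \<le> 1"
  proof -
    have "card (B t) \<le> 2" for t
      using card_mono[of "{t, Suc t}" "B t"] by (simp add: B_def)
    then have "(MAX t\<in>{..<n}. card (B t)) \<le> 2"
      using n by (subst Max_le_iff) auto
    then show ?thesis by (simp add: decomposition_width_def)
  qed
  finally show ?thesis .
qed

section \<open>Rows of small disks crossing large disks\<close>

text \<open>The premise is shared with the ply criterion, so one statement about four disks settles
  both graph classes.\<close>

lemma K4_free_intersection_graphI:
  assumes "\<And>U. U \<subseteq> I \<Longrightarrow> card U = 4 \<Longrightarrow> \<exists>u\<in>U. \<exists>v\<in>U. u \<noteq> v \<and> D u \<inter> D v = {}"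
  shows "K4_free (intersection_graph I D)"
  unfolding K4_free_def
proof safe
  fix H :: "('a, 'a \<times> 'a) pre_digraph"
  assume H: "induced_subgraph H (with_proj (intersection_graph I D))" "complete_digraph 4 H"
  then have sub: "subgraph H (with_proj (intersection_graph I D))"
    by (simp add: induced_subgraph_def)
  then have "verts H \<subseteq> I" by (auto simp: subgraph_def intersection_graph_def)
  then obtain u v where uv: "u \<in> verts H" "v \<in> verts H" "u \<noteq> v" "D u \<inter> D v = {}"
    using assms[of "verts H"] H(2) by (auto simp: complete_digraph_def)
  then have "(u, v) \<in> arcs_ends H" using H(2) by (simp add: complete_digraph_def)
  then have "(u, v) \<in> parcs (intersection_graph I D)"
    using arcs_ends_mono[OF sub] by auto
  with uv show False by (simp add: intersection_graph_def)
qed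

text \<open>Four disks through a common point would meet pairwise.\<close>

lemma has_ply_3I:
  assumes "\<And>U. U \<subseteq> I \<Longrightarrow> card U = 4 \<Longrightarrow> \<exists>u\<in>U. \<exists>v\<in>U. u \<noteq> v \<and> D u \<inter> D v = {}"
  shows "has_ply I D 3"
  unfolding has_ply_def
proof (intro allI, rule ccontr)
  fix x assume "\<not> card {i \<in> I. x \<in> D i} \<le> 3"
  then have "4 \<le> card {i \<in> I. x \<in> D i}" by simp
  then obtain U where "U \<subseteq> {i \<in> I. x \<in> D i}" "card U = 4"
    using obtain_subset_with_card_n by metis
  with assms[of U] show False by auto
qed

lemma cballs_meet_component_le:
  fixes c d :: "real ^ 'n"
  assumes "cball c r \<inter> cball d s \<noteq> {}"
  shows "\<bar>c $ i - d $ i\<bar> \<le> r + s"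
proof -
  from assms obtain x where "dist c x \<le> r" "dist d x \<le> s" by auto
  then have "norm (c - d) \<le> r + s"
    using dist_triangle2[of c d x] by (simp add: dist_norm)
  then show ?thesis using component_le_norm_cart[of "c - d" i] by simp
qed

text \<open>
  Indices below \<open>k * row_length k\<close> are the small disks, numbered row by row; the remaining \<open>k\<close>
  indices are the large disks.
\<close>

definition row_length :: "nat \<Rightarrow> nat" where
  "row_length k = 3 * k * k"

definition num_small :: "nat \<Rightarrow> nat" where
  "num_small k = k * row_length k"

text \<open>Small disks touch along a row, and rows lie 2 apart. Large disks of radius
  \<open>k\<close> span the heights from 0 to \<open>2 * k\<close>, hence all row axes. Their
  centres are \<open>3 * k\<close> apart, so a row of length \<open>3 * k * k\<close> passes through
  all \<open>k\<close> of them.\<close>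

definition crossing_disk :: "nat \<Rightarrow> nat \<Rightarrow> (real ^ 2) set" where
  "crossing_disk k t =
     (if t < num_small k
      then cball (vector [real (t mod row_length k), 2 * real (t div row_length k)]) (1 / 2)
      else cball (vector [3 * real k * real (t - num_small k), real k]) (real k))"

definition crossing_graph :: "nat \<Rightarrow> nat pair_pre_digraph" where
  "crossing_graph k = intersection_graph {..<num_small k + k} (crossing_disk k)"

lemma in_cball_vector_2:
  "vector [x, y] \<in> cball (vector [a, b] :: real ^ 2) r \<longleftrightarrow> sqrt ((a - x)\<^sup>2 + (b - y)\<^sup>2) \<le> r"
  by (simp add: dist_norm norm_vec_def L2_set_def sum_2)

section \<open>Adjacency and treewidth of the crossing graph\<close>

context
  fixes k :: nat
  assumes k: "k > 0"
begin

private abbreviation "w \<equiv> row_length k"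
private abbreviation "M \<equiv> num_small k"
private abbreviation "D \<equiv> crossing_disk k"
private abbreviation "G \<equiv> crossing_graph k"

lemma row_length_pos: "w > 0"
  using k by (simp add: row_length_def)

lemma disk_family_crossing_disk: "disk_family {..<M + k} D"
proof -
  have "closed_disk (cball c r)" if "r > 0" for c r
    using that by (auto simp: closed_disk_def)
  then show ?thesis
    using k by (simp add: disk_family_def crossing_disk_def)
qed

lemma parcs_crossing_graph:
  "(s, t) \<in> parcs G \<longleftrightarrow> s < M + k \<and> t < M + k \<and> s \<noteq> t \<and> D s \<inter> D t \<noteq> {}"
  by (auto simp: crossing_graph_def intersection_graph_def)

text \<open>Diameter 1 is less than the row distance 2, so both disks lie in one row, in columns
  differing by at most 1.\<close>

lemma small_disks_meet_consecutive:
  assumes "s < M" "t < M" "s \<noteq> t" "D s \<inter> D t \<noteq> {}"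
  shows "t = Suc s \<or> s = Suc t"
proof -
  let ?c = "\<lambda>t. vector [real (t mod w), 2 * real (t div w)] :: real ^ 2"
  have meet: "cball (?c s) (1 / 2) \<inter> cball (?c t) (1 / 2) \<noteq> {}"
    using assms by (simp add: crossing_disk_def)
  have "\<bar>2 * real (s div w) - 2 * real (t div w)\<bar> \<le> 1"
    using cballs_meet_component_le[OF meet, of 2] by simp
  then have "s div w = t div w" by linarith
  moreover have "\<bar>real (s mod w) - real (t mod w)\<bar> \<le> 1"
    using cballs_meet_component_le[OF meet, of 1] by simp
  then have "s mod w = t mod w \<or> t mod w = Suc (s mod w) \<or> s mod w = Suc (t mod w)" by linarith
  ultimately show ?thesis
    using div_mult_mod_eq[of s w] div_mult_mod_eq[of t w] \<open>s \<noteq> t\<close> by (metis add_Suc_right)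
qed

lemma large_disks_disjoint:
  assumes "s \<ge> M" "t \<ge> M" "D s \<inter> D t \<noteq> {}"
  shows "s = t"
proof -
  let ?c = "\<lambda>t. vector [3 * real k * real (t - M), real k] :: real ^ 2"
  have meet: "cball (?c s) (real k) \<inter> cball (?c t) (real k) \<noteq> {}"
    using assms by (simp add: crossing_disk_def)
  have "\<bar>3 * real k * real (s - M) - 3 * real k * real (t - M)\<bar> \<le> 2 * real k"
    using cballs_meet_component_le[OF meet, of 1] by simp
  \<comment> \<open>Cancelling the factor \<open>k\<close> leaves an inequality between integers
    that forces equality.\<close>
  also have "3 * real k * real (s - M) - 3 * real k * real (t - M)
      = real k * (3 * (real (s - M) - real (t - M)))"
    by (simp add: algebra_simps)
  finally have "real k * \<bar>3 * (real (s - M) - real (t - M))\<bar> \<le> real k * 2"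
    by (simp add: abs_mult)
  then have "\<bar>3 * (real (s - M) - real (t - M))\<bar> \<le> 2"
    using k by simp
  moreover have "a = b" if "\<bar>3 * (real a - real b)\<bar> \<le> 2" for a b :: nat
  proof -
    have "\<bar>real a - real b\<bar> < 1" using that by (simp add: abs_mult)
    then show ?thesis by linarith
  qed
  ultimately have "s - M = t - M" by blast
  with assms show ?thesis by simp
qed

lemma row_disks_meet:
  assumes "j < k" "Suc x < w"
  shows "D (j * w + x) \<inter> D (j * w + Suc x) \<noteq> {}"
proof -
  have "Suc j * w \<le> k * w" using assms by (intro mult_le_mono1) simp
  then have "j * w + Suc x < M" using assms by (simp add: num_small_def)
  moreover have "(j * w + x) mod w = x" "(j * w + x) div w = j"
    "(j * w + Suc x) mod w = Suc x" "(j * w + Suc x) div w = j"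
    using assms by (simp_all del: add_Suc_right)
  \<comment> \<open>The witness is the point of tangency, midway between the two centres.\<close>
  ultimately have "vector [real x + 1 / 2, 2 * real j] \<in> D (j * w + x) \<inter> D (j * w + Suc x)"
    unfolding crossing_disk_def by (simp add: in_cball_vector_2 del: add_Suc_right mem_cball)
  then show ?thesis by blast
qed

lemma column_lt_row_length:
  assumes "i < k"
  shows "3 * k * i < w"
  using assms k by (simp add: row_length_def)

lemma row_meets_large_disk:
  assumes "i < k" "j < k"
  shows "D (j * w + 3 * k * i) \<inter> D (M + i) \<noteq> {}"
proof -
  let ?x = "3 * k * i"
  have x: "?x < w" using assms(1) by (rule column_lt_row_length)
  have "Suc j * w \<le> k * w" using assms by (intro mult_le_mono1) simp
  then have "j * w + ?x < M" using x by (simp add: num_small_def)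
  moreover have "(j * w + ?x) mod w = ?x" "(j * w + ?x) div w = j"
    using x by simp_all
  \<comment> \<open>The small disk's centre is the witness: it lies on the vertical axis of the
    large disk, at distance \<open>\<bar>real k - 2 * real j\<bar>\<close> from its centre.\<close>
  moreover have "\<bar>real k - 2 * real j\<bar> \<le> real k" using assms(2) by linarith
  ultimately have "vector [real ?x, 2 * real j] \<in> D (j * w + ?x) \<inter> D (M + i)"
    unfolding crossing_disk_def by (simp add: in_cball_vector_2 del: mem_cball)
  then show ?thesis by blast
qed

lemma crossing_disks_no_4_clique:
  assumes U: "U \<subseteq> {..<M + k}" "card U = 4"
  shows "\<exists>u\<in>U. \<exists>v\<in>U. u \<noteq> v \<and> D u \<inter> D v = {}"
proof (rule ccontr)
  assume "\<not> ?thesis"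
  then have meet: "\<And>u v. u \<in> U \<Longrightarrow> v \<in> U \<Longrightarrow> u \<noteq> v \<Longrightarrow> D u \<inter> D v \<noteq> {}" by blast
  have fin: "finite U" using U by (metis card.infinite zero_neq_numeral)
  have "card (U \<inter> {M..}) \<le> Suc 0"
    using fin meet large_disks_disjoint by (subst card_le_Suc0_iff_eq) (auto, metis)
  moreover have "card (U \<inter> {..<M}) \<le> 2"
  proof (cases "U \<inter> {..<M} = {}")
    case False
    \<comment> \<open>All other small disks in \<open>U\<close> meet the one of least index, so only
      index \<open>Suc m\<close> remains for them.\<close>
    define m where "m = Min (U \<inter> {..<M})"
    have m: "m \<in> U \<inter> {..<M}" "\<And>t. t \<in> U \<inter> {..<M} \<Longrightarrow> m \<le> t"
      using False fin Min_in[of "U \<inter> {..<M}"] by (auto simp: m_def)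
    have "t \<in> {m, Suc m}" if "t \<in> U \<inter> {..<M}" for t
    proof (cases "t = m")
      case False
      then have "t = Suc m \<or> m = Suc t"
        using small_disks_meet_consecutive[of m t] meet[of m t] m(1) that by auto
      with m(2)[OF that] show ?thesis by auto
    qed simp
    then have "U \<inter> {..<M} \<subseteq> {m, Suc m}" by blast
    then show ?thesis using card_mono[of "{m, Suc m}" "U \<inter> {..<M}"] by simp
  qed simp
  moreover have "U = (U \<inter> {M..}) \<union> (U \<inter> {..<M})" by auto
  then have "card U \<le> card (U \<inter> {M..}) + card (U \<inter> {..<M})"
    using card_Un_le by metis
  ultimately show False using U(2) by simp
qed

text \<open>Since rows are numbered one after another, the remaining small disks form a subgraph of
  a single path.\<close>

lemma treewidth_crossing_graph_delete_large:
  "treewidth (delete_verts (with_proj G) {M..<M + k}) \<le> 1"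
proof (rule treewidth_subgraph_path_le_1)
  show "M > 0" using k row_length_pos by (simp add: num_small_def)
  show V: "verts (delete_verts (with_proj G) {M..<M + k}) = {..<M}"
    by (auto simp: delete_verts_def crossing_graph_def intersection_graph_def)
  fix s t assume "(s, t) \<in> arcs_ends (delete_verts (with_proj G) {M..<M + k})"
  then have st: "(s, t) \<in> parcs G" "s \<notin> {M..<M + k}" "t \<notin> {M..<M + k}"
    by (auto simp: delete_verts_def arcs_ends_conv)
  then have "s < M" "t < M" by (auto simp: parcs_crossing_graph)
  then show "s < M \<and> t < M \<and> (t = Suc s \<or> s = Suc t)"
    using small_disks_meet_consecutive st(1) by (simp add: parcs_crossing_graph)
qed

lemma treewidth_crossing_graph: "treewidth (with_proj G) \<ge> int k - 1"
proof (rule treewidth_ge_bramble_order)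
  interpret pair_graph G
    unfolding crossing_graph_def by (rule pair_graph_intersection_graph) simp
  define row where "row j = {j * w..<j * w + w}" for j
  define b where "b = (\<lambda>(i, j). insert (M + i) (row j))"
  let ?\<B> = "b ` ({..<k} \<times> {..<k})"
  have row_sub: "row j \<subseteq> {..<M}" if "j < k" for j
  proof -
    have "Suc j * w \<le> k * w" using that by (intro mult_le_mono1) simp
    then show ?thesis by (auto simp: row_def num_small_def)
  qed
  have cross: "j * w + 3 * k * i \<in> row j" "(j * w + 3 * k * i, M + i) \<in> parcs G"
    "(M + i, j * w + 3 * k * i) \<in> parcs G" if "i < k" "j < k" for i j
  proof -
    show row: "j * w + 3 * k * i \<in> row j"
      using column_lt_row_length[OF that(1)] by (simp add: row_def)
    show "(j * w + 3 * k * i, M + i) \<in> parcs G"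
      using row_meets_large_disk[OF that] row row_sub[OF that(2)] that(1)
      by (auto simp: parcs_crossing_graph)
    then show "(M + i, j * w + 3 * k * i) \<in> parcs G" by (rule arcs_symmetric)
  qed
  have row_conn: "connected_on (parcs G) (row j)" if "j < k" for j
    unfolding row_def
  proof (rule connected_on_interval)
    fix t assume t: "j * w \<le> t" "Suc t < j * w + w"
    then have "D t \<inter> D (Suc t) \<noteq> {}"
      using row_disks_meet[OF that, of "t - j * w"] by simp
    moreover have "Suc t < M"
      using row_sub[OF that] t subsetD[of "row j" "{..<M}" "Suc t"] by (simp add: row_def)
    ultimately have "(t, Suc t) \<in> parcs G" by (simp add: parcs_crossing_graph)
    then show "(t, Suc t) \<in> parcs G \<and> (Suc t, t) \<in> parcs G"
      using arcs_symmetric by blast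
  qed
  show "wf_digraph (with_proj G)" ..
  show "finite (verts (with_proj G))" by simp
  show "bramble (arcs_ends (with_proj G)) ?\<B>"
    unfolding bramble_def
  proof (intro conjI ballI)
    fix c assume "c \<in> ?\<B>"
    then obtain i j where ij: "i < k" "j < k" and c: "c = insert (M + i) (row j)"
      by (auto simp: b_def)
    show "c \<noteq> {}" by (simp add: c)
    show "connected_on (arcs_ends (with_proj G)) c"
      using connected_on_insert[OF row_conn[OF ij(2)] cross[OF ij]] by (simp add: c)
    fix d assume "d \<in> ?\<B>"
    then obtain i' j' where ij': "i' < k" "j' < k" and d: "d = insert (M + i') (row j')"
      by (auto simp: b_def)
    \<comment> \<open>The large disk of \<open>c\<close> is adjacent to a small disk in the row of
      \<open>d\<close>.\<close>
    show "c \<inter> d \<noteq> {} \<or> (\<exists>u\<in>c. \<exists>v\<in>d. (u, v) \<in> arcs_ends (with_proj G))"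
      using cross(1,3)[OF ij(1) ij'(2)] by (auto simp: c d)
  qed
  show "c \<subseteq> verts (with_proj G)" if "c \<in> ?\<B>" for c
    using that row_sub by (fastforce simp: b_def crossing_graph_def intersection_graph_def)
  fix S assume S: "S \<subseteq> verts (with_proj G)" "\<And>c. c \<in> ?\<B> \<Longrightarrow> S \<inter> c \<noteq> {}"
  have fin: "finite S" using S(1) finite_subset by fastforce
  show "k \<le> card S"
  proof (cases "\<forall>i<k. M + i \<in> S")
    case True
    then have "(\<lambda>i. M + i) ` {..<k} \<subseteq> S" by auto
    from card_mono[OF fin this] show ?thesis by (simp add: card_image)
  next
    case False
    then obtain i where i: "i < k" "M + i \<notin> S" by blast
    \<comment> \<open>With \<open>i\<close> fixed, the sets \<open>b (i, j)\<close> force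
      \<open>S\<close> to meet every row; \<open>s div w\<close> is the row number, so
      \<open>k\<close> different values occur.\<close>
    have "{..<k} \<subseteq> (\<lambda>s. s div w) ` S"
    proof
      fix j assume "j \<in> {..<k}"
      then have "S \<inter> insert (M + i) (row j) \<noteq> {}"
        using S(2)[of "b (i, j)"] i(1) by (auto simp: b_def)
      then obtain s where s: "s \<in> S" "j * w \<le> s" "s < j * w + w"
        using i(2) by (auto simp: row_def)
      then have "s div w = j"
        by (intro div_nat_eqI) (simp_all add: mult.commute)
      with s(1) show "j \<in> (\<lambda>s. s div w) ` S" by blast
    qed
    from card_mono[OF finite_imageI[OF fin] this] card_image_le[OF fin, of "\<lambda>s. s div w"]
    show ?thesis by simp
  qed
qed

end

section \<open>Comparison of growth rates\<close>

lemma not_truly_sublinear_treewidth_if_crossing_graphs: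
  assumes lam: "0 < lam" "lam < 1" and \<G>: "\<And>k. k > 0 \<Longrightarrow> crossing_graph k \<in> \<G>"
  shows "\<not> truly_sublinear_treewidth \<G> lam"
proof
  assume "truly_sublinear_treewidth \<G> lam"
  \<comment> \<open>The parameter \<open>\<eta>\<close> is set to 1, the treewidth bound after
    deletion of the large disks.\<close>
  then obtain \<beta> :: real where \<beta>: "\<And>G X. G \<in> \<G> \<Longrightarrow> X \<subseteq> pverts G \<Longrightarrow>
      real_of_int (treewidth (delete_verts (with_proj G) X)) \<le> 1 \<Longrightarrow>
      real_of_int (treewidth (with_proj G)) \<le> 1 + \<beta> * real (card X) powr lam"
    unfolding truly_sublinear_treewidth_def by (metis zero_less_one)
  have "filterlim (\<lambda>k. real k - \<beta> * real k powr lam) at_top at_top"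
    using lam by real_asymp
  \<comment> \<open>The threshold is 2 because the two treewidth bounds give
    \<open>real k - 1 \<le> 1 + \<beta> * real k powr lam\<close>.\<close>
  then have "eventually (\<lambda>k. real k - \<beta> * real k powr lam > 2 \<and> k > 0) at_top"
    by (intro eventually_conj eventually_gt_at_top) (simp add: filterlim_at_top_dense)
  then obtain k where k: "real k - \<beta> * real k powr lam > 2" "k > 0"
    by (auto simp: eventually_at_top_linorder)
  let ?X = "{num_small k..<num_small k + k}"
  have "real_of_int (treewidth (with_proj (crossing_graph k))) \<le> 1 + \<beta> * real (card ?X) powr lam"
    using treewidth_crossing_graph_delete_large[OF k(2)]
    by (intro \<beta> \<G> k(2)) (auto simp: crossing_graph_def intersection_graph_def)
  moreover have "real k - 1 \<le> real_of_int (treewidth (with_proj (crossing_graph k)))"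
    using treewidth_crossing_graph[OF k(2)] by linarith
  ultimately show False using k(1) by simp
qed

theorem theorem3:
  fixes lam :: real
  assumes "0 < lam" and "lam < 1"
  shows "\<not> truly_sublinear_treewidth {G \<in> disk_graphs. K4_free G} lam \<and>
         \<not> truly_sublinear_treewidth (disk_graphs_ply 3) lam"
proof
  show "\<not> truly_sublinear_treewidth {G \<in> disk_graphs. K4_free G} lam"
  proof (rule not_truly_sublinear_treewidth_if_crossing_graphs[OF assms])
    fix k :: nat assume "k > 0"
    then show "crossing_graph k \<in> {G \<in> disk_graphs. K4_free G}"
      using disk_family_crossing_disk[of k]
        K4_free_intersection_graphI[OF crossing_disks_no_4_clique[of k]]
      unfolding crossing_graph_def disk_graphs_def by blast
  qed
  show "\<not> truly_sublinear_treewidth (disk_graphs_ply 3) lam"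
  proof (rule not_truly_sublinear_treewidth_if_crossing_graphs[OF assms])
    fix k :: nat assume "k > 0"
    then show "crossing_graph k \<in> disk_graphs_ply 3"
      using disk_family_crossing_disk[of k] has_ply_3I[OF crossing_disks_no_4_clique[of k]]
      unfolding crossing_graph_def disk_graphs_ply_def by blast
  qed
qed

end
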